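(* Let $u\in\mathbf{K}[x,y,z]$, $h\in\mathbf{K}[x,y]$, let $v(x,y,t)\in\mathbf{K}[x,y,t]$ be a polynomial in three variables, and let $H=(u(x,y,z),\,v(x,y,u(x,y,z)),\,h(x,y))$, a polynomial map over $\mathbf{K}[x,y,z]$. Assume that $H(0)=0$ and that $v(x,y,t)$ has degree at least $2$ in its third variable $t$ (that is, $\deg_u v\geq 2$). If $JH$ is nilpotent, then the components $u$, $v(x,y,u)$, $h$ of $H$ are linearly dependent over $\mathbf{K}$.
   Context: $\mathbf{K}$ is an algebraically closed field. $JH$ denotes the $3\times 3$ Jacobian matrix of $H$ with respect to $(x,y,z)$.
   Formalization: K is taken to be algebraically closed of characteristic 0; in characteristic p > 0 the claim fails, e.g. u = x^p, v = t^p, h = y^p gives JH = 0 with linearly independent components. *)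

theory Defs
  imports
    "HOL-Computational_Algebra.Polynomial"
    "Jordan_Normal_Form.Matrix"
begin

text \<open>
  \<open>K[x,y,z]\<close> is rendered as the iterated polynomial ring \<open>K[x][y][z]\<close>: the innermost
  variable is \<open>x\<close> and the outermost one is \<open>z\<close>. Likewise \<open>K[x,y]\<close> is \<open>K[x][y]\<close> and
  \<open>K[x,y,t]\<close> is \<open>K[x][y][t]\<close>. With this convention, for \<open>u\<close> in \<open>K[x,y,z]\<close>, \<open>v\<close> in
  \<open>K[x,y,t]\<close> and \<open>h\<close> in \<open>K[x,y]\<close>:
  \<^item> \<open>degree v\<close> is the degree of \<open>v\<close> in \<open>t\<close>;
  \<^item> \<open>v \<circ>\<^sub>p u\<close> is \<open>v(x, y, u(x,y,z))\<close>, as it substitutes \<open>u\<close> for \<open>t\<close> and keeps the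
    coefficients, which lie in \<open>K[x,y]\<close>;
  \<^item> \<open>[:h:]\<close> is \<open>h\<close> regarded as an element of \<open>K[x,y,z]\<close>.
\<close>

type_synonym 'a poly2 = "'a poly poly"
type_synonym 'a poly3 = "'a poly poly poly"

definition eval3 :: "'a::comm_ring_1 poly3 \<Rightarrow> 'a \<Rightarrow> 'a \<Rightarrow> 'a \<Rightarrow> 'a" where
  "eval3 p a b c = poly (poly (poly p [:[:c:]:]) [:b:]) a"

definition dx :: "'a::idom poly3 \<Rightarrow> 'a poly3" where
  "dx = map_poly (map_poly pderiv)"

definition dy :: "'a::idom poly3 \<Rightarrow> 'a poly3" where
  "dy = map_poly pderiv"

definition dz :: "'a::idom poly3 \<Rightarrow> 'a poly3" where
  "dz = pderiv"

definition jacobian3 :: "'a::idom poly3 list \<Rightarrow> 'a poly3 mat" where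
  "jacobian3 F = mat_of_rows_list 3 (map (\<lambda>f. [dx f, dy f, dz f]) F)"

definition nilpotent_mat :: "'a::semiring_1 mat \<Rightarrow> bool" where
  "nilpotent_mat A \<longleftrightarrow> square_mat A \<and> (\<exists>k. A ^\<^sub>m k = 0\<^sub>m (dim_row A) (dim_row A))"

text \<open>Linear dependence over \<open>K\<close> of a family, so a repeated entry counts as a dependence.\<close>

definition lin_dependent3 :: "'a::comm_ring_1 poly3 list \<Rightarrow> bool" where
  "lin_dependent3 F \<longleftrightarrow>
    (\<exists>c. (\<exists>i<length F. c i \<noteq> 0) \<and> (\<Sum>i<length F. [:[:[:c i:]:]:] * F ! i) = 0)"

end

theory Submission
  imports Defs "Jordan_Normal_Form.Char_Poly"
begin

text \<open>
  A nilpotent \<open>3 \<times> 3\<close> matrix over a domain has characteristic polynomial \<open>\<lambda>\<^sup>3\<close>, so the trace, the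
  sum of the principal \<open>2 \<times> 2\<close> minors and the determinant of \<open>JH\<close> vanish.

  If \<open>u\<close> does not involve \<open>z\<close>, then \<open>(u, w)\<close> with \<open>w = v(x,y,u)\<close> is a plane map with nilpotent
  Jacobian matrix. The slope \<open>m = u\<^sub>x / u\<^sub>y\<close> satisfies \<open>m\<^sub>x = m m\<^sub>y\<close>, hence all iterated derivatives of
  \<open>u\<close> in direction \<open>(1, -m)\<close>, with \<open>m\<close> treated as a constant, vanish. At order \<open>deg u\<close> this is an
  algebraic equation for \<open>m\<close> over \<open>K\<close>, so \<open>m \<in> K\<close>, and then \<open>w + m u\<close> has gradient zero.

  If \<open>u\<close> has degree \<open>d > 0\<close> in \<open>z\<close>, comparing degrees in \<open>z\<close> in the trace equation
  \<open>u\<^sub>x + w\<^sub>y = 0\<close> gives \<open>u = A(z) + b(x,y)\<close> and \<open>w = V(x,y,A(z))\<close> with \<open>V\<^sub>y = - b\<^sub>x\<close>. The other two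
  equations become polynomial identities in \<open>A\<close>, and a few of their coefficients force \<open>h\<close> to be
  constant, hence \<open>h = 0\<close>.
\<close>

section \<open>Nilpotent matrices\<close>

lemma det_2:
  fixes A :: "'a::comm_ring_1 mat"
  assumes "A \<in> carrier_mat 2 2"
  shows "det A = A $$ (0,0) * A $$ (1,1) - A $$ (0,1) * A $$ (1,0)"
proof -
  have "det (mat_delete A 0 j) = mat_delete A 0 j $$ (0,0)" for j
    by (rule det_single) (use assms in \<open>auto simp: mat_delete_def\<close>)
  then show ?thesis
    using assms
    by (subst laplace_expansion_row[OF assms, of 0])
       (auto simp: cofactor_def numeral_2_eq_2 mat_delete_def)
qed

lemma det_3:
  fixes A :: "'a::comm_ring_1 mat"
  assumes "A \<in> carrier_mat 3 3"
  shows "det A = A $$ (0,0) * (A $$ (1,1) * A $$ (2,2) - A $$ (1,2) * A $$ (2,1))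
    - A $$ (0,1) * (A $$ (1,0) * A $$ (2,2) - A $$ (1,2) * A $$ (2,0))
    + A $$ (0,2) * (A $$ (1,0) * A $$ (2,1) - A $$ (1,1) * A $$ (2,0))"
proof -
  have "mat_delete A 0 j \<in> carrier_mat 2 2" for j
    using assms by (auto simp: mat_delete_def)
  note d = det_2[OF this]
  show ?thesis
    using assms
    by (subst laplace_expansion_row[OF assms, of 0], simp, unfold cofactor_def d)
       (auto simp: numeral_3_eq_3 numeral_2_eq_2 mat_delete_def algebra_simps)
qed

text \<open>As in a geometric sum, \<open>X - A\<close> divides \<open>X^j - A^j\<close> as a matrix
  over the polynomial ring. At \<open>j = k\<close> the dividend is the scalar matrix
  \<open>X^k\<close>, and determinants give the divisibility.\<close>

lemma char_poly_dvd_monom: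
  fixes A :: "'a::comm_ring_1 mat"
  assumes A: "A \<in> carrier_mat n n" and nil: "A ^\<^sub>m k = 0\<^sub>m n n"
  shows "char_poly A dvd monom 1 (k * n)"
proof -
  let ?X = "[:0, 1:] :: 'a poly"
  let ?C = "map_mat (\<lambda>a. [:a:]) A"
  let ?M = "char_poly_matrix A"
  interpret C: comm_ring_hom "\<lambda>a::'a. [:a:]"
    by unfold_locales (auto simp: one_pCons)
  have C: "?C \<in> carrier_mat n n" and M: "?M \<in> carrier_mat n n"
    using A by auto
  have M_eq: "?M = ?X \<cdot>\<^sub>m 1\<^sub>m n - ?C"
    using A unfolding char_poly_matrix_def by (intro eq_matI) auto
  have "\<exists>B \<in> carrier_mat n n. B * ?M = ?X ^ j \<cdot>\<^sub>m 1\<^sub>m n - ?C ^\<^sub>m j" for j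
  proof (induction j)
    case 0
    show ?case
      by (rule bexI[of _ "0\<^sub>m n n"]) (use A left_mult_zero_mat[OF M] in \<open>auto intro!: eq_matI\<close>)
  next
    case (Suc j)
    then obtain B where B: "B \<in> carrier_mat n n"
      and BM: "B * ?M = ?X ^ j \<cdot>\<^sub>m 1\<^sub>m n - ?C ^\<^sub>m j" by blast
    have P: "?C ^\<^sub>m j \<in> carrier_mat n n" using C by simp
    have "(?C ^\<^sub>m j + ?X \<cdot>\<^sub>m B) * ?M = ?C ^\<^sub>m j * ?M + ?X \<cdot>\<^sub>m (B * ?M)"
      using M P B by (simp add: add_mult_distrib_mat[of _ n n] mult_smult_assoc_mat[of _ n n])
    also have "?C ^\<^sub>m j * ?M = ?X \<cdot>\<^sub>m ?C ^\<^sub>m j - ?C ^\<^sub>m Suc j"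
      by (simp add: M_eq mult_minus_distrib_mat[OF P _ C] mult_smult_distrib[OF P one_carrier_mat]
          right_mult_one_mat[OF P])
    also have "\<dots> + ?X \<cdot>\<^sub>m (B * ?M) = ?X ^ Suc j \<cdot>\<^sub>m 1\<^sub>m n - ?C ^\<^sub>m Suc j"
      unfolding BM using C P by (intro eq_matI) (auto simp: algebra_simps)
    finally show ?case
      using B P by (intro bexI[of _ "?C ^\<^sub>m j + ?X \<cdot>\<^sub>m B"]) auto
  qed
  then obtain B where B: "B \<in> carrier_mat n n"
    and BM: "B * ?M = ?X ^ k \<cdot>\<^sub>m 1\<^sub>m n - ?C ^\<^sub>m k" by blast
  have "?C ^\<^sub>m k = 0\<^sub>m n n"
    by (simp flip: C.mat_hom_pow[OF A] add: nil) (auto intro!: eq_matI)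
  with BM have "B * ?M = ?X ^ k \<cdot>\<^sub>m 1\<^sub>m n" by auto
  then have "det B * det ?M = (?X ^ k) ^ n"
    using det_mult[OF B M] by simp
  also have "\<dots> = monom 1 (k * n)"
    by (simp add: monom_altdef power_mult)
  finally show ?thesis
    unfolding char_poly_def by (metis dvd_triv_right)
qed

text \<open>Over a domain, order at 0 and degree are additive, and the order never exceeds the
  degree. They agree on a monomial, hence on each of its factors.\<close>

lemma coeff_eq_0_if_dvd_monom:
  fixes f :: "'a::idom poly"
  assumes "f dvd monom 1 m" and "i < degree f"
  shows "coeff f i = 0"
proof -
  obtain g where fg: "monom 1 m = f * g" using assms(1) by blast
  have nz: "f * g \<noteq> 0" "f \<noteq> 0" "g \<noteq> 0" using fg[symmetric] by (auto simp: monom_eq_0_iff)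
  have "order 0 (f * g) = m"
    by (simp flip: fg add: order_0_monom)
  moreover have "degree (f * g) = m"
    by (simp flip: fg add: degree_monom_eq)
  ultimately have "order 0 f + order 0 g = degree f + degree g"
    using nz by (simp add: order_mult degree_mult_eq)
  moreover have "order 0 f \<le> degree f" "order 0 g \<le> degree g"
    using nz by (auto intro: order_degree)
  ultimately have "degree f \<le> order 0 f" by simp
  then have "monom 1 (degree f) dvd f"
    using nz by (simp add: monom_1_dvd_iff)
  then show ?thesis using assms(2) by (simp add: monom_1_dvd_iff')
qed

lemma nilpotent_mat_3:
  fixes A :: "'a::idom mat"
  assumes A: "A \<in> carrier_mat 3 3" and nil: "nilpotent_mat A"
  shows "A $$ (0,0) + A $$ (1,1) + A $$ (2,2) = 0"
    and "A $$ (0,0) * A $$ (1,1) - A $$ (0,1) * A $$ (1,0)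
      + (A $$ (0,0) * A $$ (2,2) - A $$ (0,2) * A $$ (2,0))
      + (A $$ (1,1) * A $$ (2,2) - A $$ (1,2) * A $$ (2,1)) = 0"
    and "det A = 0"
proof -
  obtain k where "A ^\<^sub>m k = 0\<^sub>m 3 3"
    using nil A unfolding nilpotent_mat_def by auto
  then have dvd: "char_poly A dvd monom 1 (k * 3)"
    by (rule char_poly_dvd_monom[OF A])
  have deg: "degree (char_poly A) = 3"
    using degree_monic_char_poly[OF A] by simp
  have co: "coeff (char_poly A) i = 0" if "i < 3" for i
    using coeff_eq_0_if_dvd_monom[OF dvd] that deg by simp
  have "char_poly A = [: - det A,
      A $$ (0,0) * A $$ (1,1) - A $$ (0,1) * A $$ (1,0)
      + (A $$ (0,0) * A $$ (2,2) - A $$ (0,2) * A $$ (2,0))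
      + (A $$ (1,1) * A $$ (2,2) - A $$ (1,2) * A $$ (2,1)),
      - (A $$ (0,0) + A $$ (1,1) + A $$ (2,2)), 1 :]"
    unfolding char_poly_def
    by (subst det_3[of "char_poly_matrix A"], use A in simp)
       (use A in \<open>simp add: det_3[OF A] char_poly_matrix_def algebra_simps\<close>)
  then show "A $$ (0,0) + A $$ (1,1) + A $$ (2,2) = 0"
    and "A $$ (0,0) * A $$ (1,1) - A $$ (0,1) * A $$ (1,0)
      + (A $$ (0,0) * A $$ (2,2) - A $$ (0,2) * A $$ (2,0))
      + (A $$ (1,1) * A $$ (2,2) - A $$ (1,2) * A $$ (2,1)) = 0"
    and "det A = 0"
    using co[of 0] co[of 1] co[of 2] by (auto simp: numeral_2_eq_2 add_eq_0_iff)
qed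

section \<open>Derivations\<close>

locale derivation =
  fixes D :: "'a::idom \<Rightarrow> 'a"
  assumes add: "D (a + b) = D a + D b"
    and mult: "D (a * b) = a * D b + D a * b"
begin

lemma zero [simp]: "D 0 = 0"
  using add[of 0 0] by (metis add.right_neutral add_left_cancel)

lemma one [simp]: "D 1 = 0"
  using mult[of 1 1] by (metis add_cancel_right_right mult.left_neutral mult.right_neutral)

lemma minus: "D (- a) = - D a"
  using add[of a "- a"] by (simp add: add_eq_0_iff)

lemma sum: "D (sum f S) = (\<Sum>i\<in>S. D (f i))"
  by (induction S rule: infinite_finite_induct) (auto simp: add)

lemma of_nat_mult: "D (of_nat n * a) = of_nat n * D a"
  by (induction n) (auto simp: add distrib_right)

lemma coeff_map_poly: "coeff (map_poly D p) i = D (coeff p i)"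
  by (simp add: Polynomial.coeff_map_poly)

lemma map_poly_pCons: "map_poly D (pCons a p) = pCons (D a) (map_poly D p)"
  by (simp add: Polynomial.map_poly_pCons)

lemma derivation_map_poly: "derivation (map_poly D)"
proof
  show "map_poly D (p + q) = map_poly D p + map_poly D q" for p q
    by (rule poly_eqI) (simp add: coeff_map_poly add)
  show "map_poly D (p * q) = p * map_poly D q + map_poly D p * q" for p q
    by (rule poly_eqI) (simp add: coeff_map_poly coeff_mult sum mult sum.distrib)
qed

text \<open>The chain rule for a derivation of the coefficient ring: it acts on the coefficients of
  \<open>p\<close> and, through \<open>q\<close>, on the substituted variable.\<close>

lemma map_poly_pcompose:
  "map_poly D (p \<circ>\<^sub>p q) = map_poly D p \<circ>\<^sub>p q + (pderiv p \<circ>\<^sub>p q) * map_poly D q"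
proof (induction p)
  case (pCons a p)
  interpret P: derivation "map_poly D" by (rule derivation_map_poly)
  show ?case
    by (simp add: pcompose_pCons map_poly_pCons P.add P.mult pCons.IH pderiv_pCons
        pcompose_add algebra_simps)
qed simp

text \<open>The hypothesis says \<open>D (a/b) = 0\<close> without fractions, so \<open>a\<close>
  has the logarithmic derivative of \<open>b\<close>. It holds trivially for
  \<open>a = b\<close>.\<close>

lemma power_mult_self:
  assumes "b * D a = D b * a"
  shows "b * D (a ^ i) = of_nat i * D b * a ^ i"
proof (induction i)
  case (Suc i)
  have "b * D (a ^ Suc i) = a * (b * D (a ^ i)) + (b * D a) * a ^ i"
    by (simp add: mult algebra_simps)
  then show ?case unfolding Suc assms by (simp add: algebra_simps)
qed simp

end

lemma derivation_pderiv: "derivation (pderiv :: 'a::idom poly \<Rightarrow> _)"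
  by unfold_locales (auto simp: pderiv_add pderiv_mult algebra_simps)

section \<open>Plane maps with nilpotent Jacobian matrix\<close>

text \<open>For \<open>degree p\<close> at most \<open>n\<close> and nonzero \<open>b\<close> this
  is \<open>b^n p(a/b)\<close>; the slope \<open>a/b\<close> can thus be inserted without a fraction
  field.\<close>

definition homog :: "nat \<Rightarrow> 'a::comm_ring_1 poly \<Rightarrow> 'a \<Rightarrow> 'a \<Rightarrow> 'a" where
  "homog n p a b = (\<Sum>i\<le>n. coeff p i * a ^ i * b ^ (n - i))"

lemma homog_diff: "homog n (p - q) a b = homog n p a b - homog n q a b"
  by (simp add: homog_def sum_subtractf algebra_simps)

lemma homog_smult: "homog n (Polynomial.smult c p) a b = c * homog n p a b"
  by (simp add: homog_def sum_distrib_left algebra_simps)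

lemma homog_Suc_pCons_0: "homog (Suc n) (pCons 0 p) a b = a * homog n p a b"
  by (simp add: homog_def sum.atMost_Suc_shift sum_distrib_left algebra_simps del: sum.atMost_Suc)

lemma homog_Suc:
  assumes "degree p \<le> n"
  shows "homog (Suc n) p a b = b * homog n p a b"
  using assms
  by (auto simp: homog_def sum_distrib_left Suc_diff_le coeff_eq_0 algebra_simps intro!: sum.cong)

abbreviation const2 :: "'a::zero \<Rightarrow> 'a poly poly" where
  "const2 c \<equiv> [:[:c:]:]"

text \<open>A form with coefficients in \<open>K\<close> splits into linear forms, one of which vanishes.\<close>

lemma homog_const2_eq_0_imp_ratio_const:
  fixes p :: "'a::alg_closed_field poly"
  assumes "homog n (map_poly const2 p) a b = 0" "p \<noteq> 0" "degree p \<le> n" "b \<noteq> 0"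
  shows "\<exists>r. a = const2 r * b"
  using assms
proof (induction n arbitrary: p)
  case 0
  then obtain c where "p = [:c:]" "c \<noteq> 0" by (metis degree_eq_zeroE le_zero_eq pCons_0_0)
  with 0 show ?case by (simp add: homog_def coeff_map_poly)
next
  case (Suc n)
  show ?case
  proof (cases "degree p \<le> n")
    case True
    have "degree (map_poly const2 p) \<le> n"
      using True by (intro degree_le) (auto simp: coeff_map_poly coeff_eq_0)
    with Suc True show ?thesis by (simp add: homog_Suc)
  next
    \<comment> \<open>A root \<open>r\<close> of \<open>p\<close> splits off the factor
      \<open>a - r b\<close>; the cofactor is a form of degree \<open>n\<close>.\<close>
    case False
    then obtain r where "poly p r = 0"
      using alg_closed_imp_poly_has_root[of p] by auto
    then obtain q where pq: "p = [:-r, 1:] * q" by (auto simp: poly_eq_0_iff_dvd)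
    with Suc.prems have q: "q \<noteq> 0" "degree q \<le> n" by (auto simp: degree_mult_eq simp del: mult_pCons_left)
    have dq: "degree (map_poly const2 q) \<le> n"
      using q by (intro degree_le) (auto simp: coeff_map_poly coeff_eq_0)
    have "map_poly const2 p = pCons 0 (map_poly const2 q) - Polynomial.smult (const2 r) (map_poly const2 q)"
      unfolding pq by (rule poly_eqI) (simp add: coeff_map_poly coeff_pCons split: nat.split)
    then have "homog (Suc n) (map_poly const2 p) a b = (a - const2 r * b) * homog n (map_poly const2 q) a b"
      by (simp only: homog_diff homog_smult homog_Suc_pCons_0 homog_Suc[OF dq] left_diff_distrib mult.assoc)
    with Suc.prems consider "a - const2 r * b = 0" | "homog n (map_poly const2 q) a b = 0"
      by (metis mult_eq_0_iff)
    then show ?thesis using Suc.IH[of q] q Suc.prems by cases auto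
  qed
qed

text \<open>The \<open>k\<close>-th derivative of \<open>u\<close> in direction \<open>(1, -\<mu>)\<close>, as a polynomial in \<open>\<mu>\<close>.\<close>

primrec dirderiv :: "('a::idom \<Rightarrow> 'a) \<Rightarrow> ('a \<Rightarrow> 'a) \<Rightarrow> 'a \<Rightarrow> nat \<Rightarrow> 'a poly" where
  "dirderiv X Y u 0 = [:u:]"
| "dirderiv X Y u (Suc k) =
    map_poly X (dirderiv X Y u k) - pCons 0 (map_poly Y (dirderiv X Y u k))"

locale commuting_derivations = X: derivation X + Y: derivation Y
  for X Y :: "'a::idom \<Rightarrow> 'a" +
  assumes commute: "X (Y f) = Y (X f)"
begin

lemma funpow_commute: "Y ((X ^^ i) f) = (X ^^ i) (Y f)"
  by (induction i) (simp_all flip: commute)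

text \<open>The binomial expansion of \<open>(X - mu Y)^k\<close>, valid because \<open>X\<close>
  and \<open>Y\<close> commute.\<close>

lemma coeff_dirderiv:
  "coeff (dirderiv X Y u k) i = (-1) ^ i * of_nat (k choose i) * (X ^^ (k - i)) ((Y ^^ i) u)"
proof (induction k arbitrary: i)
  case 0
  show ?case by (cases i) auto
next
  case (Suc k)
  have D: "X ((-1) ^ j * of_nat m * f) = (-1) ^ j * of_nat m * X f"
    "Y ((-1) ^ j * of_nat m * f) = (-1) ^ j * of_nat m * Y f" for j m f
    by (cases "even j"; simp add: X.minus Y.minus X.of_nat_mult Y.of_nat_mult)+
  show ?case
  proof (cases i)
    case 0
    then show ?thesis by (simp add: X.coeff_map_poly Suc)
  next
    case (Suc j)
    \<comment> \<open>The subtraction \<open>k - Suc j\<close> truncates once \<open>j\<close>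
      reaches \<open>k\<close>, but there the binomial coefficient is zero.\<close>
    have "X ((X ^^ (k - Suc j)) ((Y ^^ Suc j) u)) = (X ^^ (k - j)) ((Y ^^ Suc j) u)" if "Suc j \<le> k"
      using that by (metis Suc_diff_Suc Suc_le_lessD comp_apply funpow.simps(2))
    moreover have "k choose Suc j = 0" if "\<not> Suc j \<le> k" using that by simp
    ultimately have "of_nat (k choose Suc j) * X ((X ^^ (k - Suc j)) ((Y ^^ Suc j) u))
      = of_nat (k choose Suc j) * (X ^^ (k - j)) ((Y ^^ Suc j) u)"
      by (metis mult_zero_left of_nat_0)
    moreover have "coeff (dirderiv X Y u (Suc k)) (Suc j)
        = (-1) ^ Suc j * of_nat (k choose Suc j) * X ((X ^^ (k - Suc j)) ((Y ^^ Suc j) u))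
          - (-1) ^ j * of_nat (k choose j) * Y ((X ^^ (k - j)) ((Y ^^ j) u))"
      by (simp only: dirderiv.simps coeff_diff coeff_pCons_Suc X.coeff_map_poly Y.coeff_map_poly
          Suc.IH D)
    ultimately show ?thesis
      by (simp only: Suc funpow_commute binomial_Suc_Suc of_nat_add diff_Suc_Suc)
         (auto simp: algebra_simps)
  qed
qed

lemma degree_dirderiv: "degree (dirderiv X Y u k) \<le> k"
  by (rule degree_le) (simp add: coeff_dirderiv binomial_eq_0)

text \<open>The slope \<open>m = X u / Y u\<close> is a constant of the field \<open>X - m Y\<close>, so differentiating along
  \<open>X - m Y\<close> raises the order of the directional derivatives at \<open>\<mu> = m\<close>.\<close>

lemma homog_dirderiv_eq_0:
  assumes "X u + Y w = 0" "X u * Y w - Y u * X w = 0" "Y u \<noteq> 0"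
  shows "homog (Suc k) (dirderiv X Y u (Suc k)) (X u) (Y u) = 0"
proof (induction k)
  case 0
  show ?case by (simp add: homog_def X.coeff_map_poly Y.coeff_map_poly X.map_poly_pCons Y.map_poly_pCons)
next
  case (Suc k)
  define a b where "a = X u" and "b = Y u"
  \<comment> \<open>\<open>D\<close> is \<open>b\<close> times the derivation \<open>X - m Y\<close>
    with \<open>m = a/b\<close>.\<close>
  define D where "D f = b * X f - a * Y f" for f
  interpret D: derivation D
    by unfold_locales (auto simp: D_def X.add Y.add X.mult Y.mult algebra_simps)
  have w: "Y w = - a" "b * X w = - (a * a)"
    using assms by (auto simp: a_def b_def add_eq_0_iff)
  have Xb: "X b = Y a" by (simp add: a_def b_def commute)
  \<comment> \<open>Since \<open>Y (X w) = X (Y w) = - X a\<close>, differentiating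
    \<open>b X w = - a^2\<close> removes the second derivatives of \<open>w\<close>. What results is
    \<open>D m = 0\<close>, cleared of denominators.\<close>
  have "Y (b * X w) = Y (- (a * a))" using w by simp
  then have "Y b * X w - b * X a = - 2 * a * Y a"
    by (simp add: Y.mult Y.minus w(1) X.minus flip: commute)
  then have "b * (Y b * X w - b * X a) = b * (- 2 * a * Y a)" by simp
  moreover have "b * (Y b * X w) = - (a * a * Y b)"
    using arg_cong[OF w(2), of "(*) (Y b)"] by (simp add: algebra_simps)
  ultimately have ab: "b * D a = D b * a"
    by (simp add: D_def Xb algebra_simps)
  define n where "n = Suc k"
  define T where "T = dirderiv X Y u n"
  have mono: "b * D (a ^ i * b ^ j) = of_nat (i + j) * D b * (a ^ i * b ^ j)" for i j
  proof -
    have "b * D (a ^ i * b ^ j) = a ^ i * (b * D (b ^ j)) + (b * D (a ^ i)) * b ^ j"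
      by (simp add: D.mult algebra_simps)
    then show ?thesis
      by (simp add: D.power_mult_self[OF ab] D.power_mult_self[of b b] algebra_simps)
  qed
  have summand: "b * D (coeff T i * a ^ i * b ^ (n - i))
      = of_nat n * D b * (coeff T i * a ^ i * b ^ (n - i)) + b * (D (coeff T i) * a ^ i * b ^ (n - i))"
    if "i \<le> n" for i
    using mono[of i "n - i"] that D.mult[of "coeff T i" "a ^ i * b ^ (n - i)"]
    by (simp add: algebra_simps)
  \<comment> \<open>All monomials of degree \<open>n\<close> scale by the same factor, so their part
    of the derivative is a multiple of the relation at hand and drops out. The differentiated
    coefficients form the relation of the next order.\<close>
  have "b * D (homog n T a b) = of_nat n * D b * homog n T a b
      + b * (\<Sum>i\<le>n. D (coeff T i) * a ^ i * b ^ (n - i))"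
    unfolding homog_def D.sum sum_distrib_left sum.distrib[symmetric]
    by (intro sum.cong) (use summand in auto)
  moreover have "homog n T a b = 0"
    using Suc unfolding T_def n_def a_def b_def by simp
  ultimately have "(\<Sum>i\<le>n. D (coeff T i) * a ^ i * b ^ (n - i)) = 0"
    using \<open>Y u \<noteq> 0\<close> by (simp add: b_def)
  moreover have "degree (map_poly X T) \<le> n"
    using map_poly_degree_leq[of X T] degree_dirderiv[of u n] unfolding T_def by linarith
  then have "homog (Suc n) (dirderiv X Y u (Suc n)) a b
      = b * homog n (map_poly X T) a b - a * homog n (map_poly Y T) a b"
    by (simp add: homog_diff homog_Suc homog_Suc_pCons_0 flip: T_def)
  moreover have "\<dots> = (\<Sum>i\<le>n. D (coeff T i) * a ^ i * b ^ (n - i))"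
    by (simp add: homog_def X.coeff_map_poly Y.coeff_map_poly sum_distrib_left D_def
        flip: sum_subtractf) (simp add: algebra_simps)
  ultimately show ?case by (simp add: n_def a_def b_def)
qed

end

section \<open>Partial derivatives on K[x,y] and the plane case\<close>

lemma commuting_derivations_pderiv:
  "commuting_derivations (map_poly pderiv) (pderiv :: 'a::idom poly poly \<Rightarrow> _)"
proof -
  interpret P: derivation "pderiv :: 'a poly \<Rightarrow> _" by (rule derivation_pderiv)
  interpret X: derivation "map_poly (pderiv :: 'a poly \<Rightarrow> _)" by (rule P.derivation_map_poly)
  interpret Y: derivation "pderiv :: 'a poly poly \<Rightarrow> _" by (rule derivation_pderiv)
  show ?thesis
  proof
    show "map_poly pderiv (pderiv f) = pderiv (map_poly pderiv f)" for f :: "'a poly poly"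
      by (rule poly_eqI) (simp only: P.coeff_map_poly coeff_pderiv P.of_nat_mult)
  qed
qed

lemma gradient_eq_0_imp_const2:
  fixes f :: "'a::{idom, ring_char_0} poly poly"
  assumes "map_poly pderiv f = 0" "pderiv f = 0"
  shows "\<exists>c. f = const2 c"
proof -
  obtain g where g: "f = [:g:]"
    using assms(2) pderiv_eq_0_iff[of f] degree_eq_zeroE[of f] by blast
  then have "pderiv g = 0" using assms(1) by (simp add: Polynomial.map_poly_pCons)
  then show ?thesis using g pderiv_eq_0_iff[of g] degree_eq_zeroE[of g] by blast
qed

text \<open>Finiteness of the degree in the inner variable, without naming that degree.\<close>

lemma map_poly_pderiv_funpow_eq_0: "\<exists>m. \<forall>i\<ge>m. (map_poly pderiv ^^ i) (f :: 'a::idom poly poly) = 0"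
proof (induction f)
  case 0
  interpret commuting_derivations "map_poly pderiv" "pderiv :: 'a poly poly \<Rightarrow> _"
    by (rule commuting_derivations_pderiv)
  have "(map_poly pderiv ^^ i) (0 :: 'a poly poly) = 0" for i
    by (induction i) auto
  then show ?case by blast
next
  case (pCons c f)
  then obtain m where m: "\<forall>i\<ge>m. (map_poly pderiv ^^ i) f = 0" by blast
  have "(map_poly pderiv ^^ i) (pCons c f) = pCons ((pderiv ^^ i) c) ((map_poly pderiv ^^ i) f)" for i
    by (induction i) (auto simp: Polynomial.map_poly_pCons)
  moreover have "(pderiv ^^ i) c = 0" if "i \<ge> Suc (degree c)" for i
    using that by (intro poly_eqI) (simp add: coeff_higher_pderiv coeff_eq_0)
  ultimately have "\<forall>i\<ge>max m (Suc (degree c)). (map_poly pderiv ^^ i) (pCons c f) = 0"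
    using m by simp
  then show ?case by (rule exI)
qed

text \<open>The constant \<open>e\<close> stays free because gradients determine a combination only
  up to a constant.\<close>

lemma nilpotent_jacobian_2:
  fixes u w :: "'a::{alg_closed_field, field_char_0} poly poly"
  assumes trace: "map_poly pderiv u + pderiv w = 0"
    and det: "map_poly pderiv u * pderiv w - pderiv u * map_poly pderiv w = 0"
  shows "\<exists>c d e. (c \<noteq> 0 \<or> d \<noteq> 0) \<and> const2 c * u + const2 d * w = const2 e"
proof (cases "pderiv u = 0")
  case True
  with trace det have "map_poly pderiv u = 0" by (simp add: add_eq_0_iff)
  with True obtain e where "u = const2 e" using gradient_eq_0_imp_const2 by blast
  then show ?thesis by (intro exI[of _ 1] exI[of _ 0] exI[of _ e]) (simp flip: one_pCons)
next
  case False
  let ?X = "map_poly pderiv :: 'a poly poly \<Rightarrow> _" and ?Y = "pderiv :: 'a poly poly \<Rightarrow> _"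
  interpret commuting_derivations ?X ?Y
    by (rule commuting_derivations_pderiv)
  let ?F = "\<lambda>i j. (?X ^^ i) ((?Y ^^ j) u)"
  \<comment> \<open>The least \<open>N\<close> with \<open>P N\<close> is the total degree of
    \<open>u\<close> plus one. The partial derivatives of order \<open>k = N - 1\<close> are then
    constants, not all zero.\<close>
  define P where "P N \<longleftrightarrow> (\<forall>i j. i + j = N \<longrightarrow> ?F i j = 0)" for N
  obtain m where m: "\<forall>i\<ge>m. (?X ^^ i) u = 0" using map_poly_pderiv_funpow_eq_0 by blast
  have F: "?F i j = (?Y ^^ j) ((?X ^^ i) u)" for i j
    by (induction j) (simp_all flip: funpow_commute)
  have "(?Y ^^ j) u = 0" if "j \<ge> Suc (degree u)" for j
    using that by (intro poly_eqI) (simp add: coeff_higher_pderiv coeff_eq_0)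
  moreover have "(?X ^^ i) 0 = 0" "(?Y ^^ i) 0 = 0" for i by (induction i) auto
  ultimately have "?F i j = 0" if "i \<ge> m \<or> j \<ge> Suc (degree u)" for i j
    using that m F by metis
  moreover have "i \<ge> m \<or> j \<ge> Suc (degree u)" if "i + j = m + Suc (degree u)" for i j
    using that by linarith
  ultimately have "P (m + Suc (degree u))" unfolding P_def by blast
  then obtain N where "P N" and least: "\<And>M. M < N \<Longrightarrow> \<not> P M"
    using LeastI not_less_Least by metis
  then have N: "?F i j = 0" if "i + j = N" for i j using that unfolding P_def by blast
  have "u \<noteq> 0" using False by auto
  then obtain k where k: "N = Suc k" using N[of 0 0] by (cases N) auto
  obtain i0 where i0: "i0 \<le> k" "?F (k - i0) i0 \<noteq> 0"
  proof -
    obtain i j where "i + j = k" "?F i j \<noteq> 0"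
      using least[of k] k unfolding P_def by auto
    then show thesis using that[of j] by auto
  qed
  have "\<exists>c. ?F (k - i) i = const2 c" if "i \<le> k" for i
  proof (rule gradient_eq_0_imp_const2)
    have "?F (Suc (k - i)) i = 0" "?F (k - i) (Suc i) = 0"
      by (rule N, use that k in simp)+
    then show "?X (?F (k - i) i) = 0" "?Y (?F (k - i) i) = 0"
      by (simp_all add: funpow_commute)
  qed
  then obtain c where c: "\<And>i. i \<le> k \<Longrightarrow> ?F (k - i) i = const2 (c i)" by metis
  \<comment> \<open>\<open>p\<close> is the directional derivative of order \<open>k\<close>, now
    with coefficients in K, so its homogenised relation forces the slope into K.\<close>
  define p where "p = (\<Sum>i\<le>k. monom ((-1) ^ i * of_nat (k choose i) * c i) i)"
  have coeff_p: "coeff p i = (if i \<le> k then (-1) ^ i * of_nat (k choose i) * c i else 0)" for i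
    by (auto simp: p_def coeff_sum)
  have "dirderiv ?X ?Y u k = map_poly const2 p"
  proof (rule poly_eqI)
    fix i
    have "(-1) ^ i * of_nat n * const2 x = const2 ((-1) ^ i * of_nat n * x)" for n :: nat and x :: 'a
      by (cases "even i") (simp_all add: of_nat_poly)
    then show "coeff (dirderiv ?X ?Y u k) i = coeff (map_poly const2 p) i"
      by (simp add: coeff_dirderiv coeff_map_poly coeff_p c binomial_eq_0)
  qed
  moreover have "k \<noteq> 0"
    using N[of 0 1] k False by auto
  ultimately have "homog k (map_poly const2 p) (?X u) (?Y u) = 0"
    using homog_dirderiv_eq_0[OF trace det False, of "k - 1"] by simp
  moreover have "coeff p i0 \<noteq> 0"
    using i0 c[of i0] by (auto simp: coeff_p)
  then have "p \<noteq> 0" by auto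
  moreover have "degree p \<le> k" by (rule degree_le) (simp add: coeff_p)
  ultimately obtain r where r: "?X u = const2 r * ?Y u"
    using homog_const2_eq_0_imp_ratio_const[of k p "?X u" "?Y u"] False by auto
  have Yw: "?Y w = - (const2 r * ?Y u)" using trace r by (simp add: add_eq_0_iff)
  have "?Y u * (?X w + const2 r * ?X u) = - (?X u * ?Y w - ?Y u * ?X w)"
    unfolding Yw by (simp add: algebra_simps)
  then have Xw: "?X w + const2 r * ?X u = 0" using False det by simp
  have c: "?X (const2 r) = 0" "?Y (const2 r) = 0" by (simp_all add: Polynomial.map_poly_pCons)
  have "?X (const2 r * u + w) = 0"
    unfolding X.add X.mult c using Xw by (simp add: add.commute)
  moreover have "?Y (const2 r * u + w) = 0"
    unfolding Y.add Y.mult c Yw by simp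
  ultimately obtain e where "const2 r * u + w = const2 e" using gradient_eq_0_imp_const2 by blast
  then show ?thesis by (intro exI[of _ r] exI[of _ 1] exI[of _ e]) (simp flip: one_pCons)
qed

section \<open>Maps with a third component in two variables\<close>

text \<open>The hypotheses are coefficients of the minor and determinant equations when
  \<open>A\<close> is linear in z. Elimination gives \<open>b2 E = c h2^2\<close> and
  \<open>b1 E = c h1 h2\<close> for \<open>E = b2 h1 - b1 h2\<close>; hence \<open>E^2 = 0\<close>,
  and then \<open>h2 = 0\<close>.\<close>

lemma quadratic_relations_contradiction:
  fixes c m p q b1 b2 h1 h2 g :: "'a::idom"
  assumes "b1 * b1 + b2 * p + c * (h1 + q * h2) = 0"
    and "b2 * g + c * (m * h2) = 0"
    and "m * (b2 * h1 - b1 * h2) + g * h2 = 0"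
    and "q * (b2 * h1 - b1 * h2) + p * h2 + b1 * h1 = 0"
    and "c \<noteq> 0" "m \<noteq> 0"
  shows "h2 = 0"
proof -
  define E where "E = b2 * h1 - b1 * h2"
  have "m * (b2 * E - c * h2 * h2) =
      b2 * (m * (b2 * h1 - b1 * h2) + g * h2) - h2 * (b2 * g + c * (m * h2))"
    by (simp add: E_def algebra_simps)
  with assms have 1: "b2 * E = c * h2 * h2" by simp
  have "b1 * E - c * h1 * h2 + q * (b2 * E - c * h2 * h2) =
      b2 * (q * (b2 * h1 - b1 * h2) + p * h2 + b1 * h1)
      - h2 * (b1 * b1 + b2 * p + c * (h1 + q * h2))"
    by (simp add: E_def algebra_simps)
  with assms 1 have 2: "b1 * E = c * h1 * h2" by simp
  have "E * E = h1 * (b2 * E) - h2 * (b1 * E)"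
    by (simp add: E_def algebra_simps)
  then have "E = 0" unfolding 1 2 by (simp add: algebra_simps)
  with 1 \<open>c \<noteq> 0\<close> show ?thesis by simp
qed

lemma degree_le_minus_1:
  assumes "degree p \<le> n" and "coeff p n = 0"
  shows "degree p \<le> n - 1"
proof (rule degree_le, intro allI impI)
  show "coeff p i = 0" if "n - 1 < i" for i
    using assms that by (cases "i = n") (auto intro: coeff_eq_0)
qed

lemma dx_const: "dx [:f:] = [:map_poly pderiv f:]"
  and dy_const: "dy [:f:] = [:pderiv f:]"
  and dz_const: "dz [:f:] = 0"
  by (rule poly_eqI; simp add: dx_def dy_def dz_def coeff_map_poly coeff_pCons split: nat.split)+

text \<open>Since \<open>n\<close> is at least 2, the z-degree \<open>n d\<close> of
  \<open>W\<close> exceeds that of \<open>u\<close>; comparing top coefficients therefore isolates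
  \<open>v\<close>.\<close>

lemma nilpotent_jacobian_3_third_constant:
  fixes u v :: "'a::field_char_0 poly3" and h :: "'a poly2"
  defines "W \<equiv> v \<circ>\<^sub>p u"
  assumes deg_u: "degree u > 0" and deg_v: "degree v \<ge> 2"
    and trace: "dx u + dy W = 0"
    and minors: "dx u * dy W - dy u * dx W - dz u * [:map_poly pderiv h:] - dz W * [:pderiv h:] = 0"
    and det: "dx u * (- (dz W * [:pderiv h:])) + dy u * (dz W * [:map_poly pderiv h:])
      + dz u * (dx W * [:pderiv h:] - dy W * [:map_poly pderiv h:]) = 0"
  shows "map_poly pderiv h = 0 \<and> pderiv h = 0"
proof -
  let ?X = "map_poly pderiv :: 'a poly2 \<Rightarrow> 'a poly2" and ?Y = "pderiv :: 'a poly2 \<Rightarrow> 'a poly2"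
  interpret commuting_derivations ?X ?Y by (rule commuting_derivations_pderiv)
  interpret DX: derivation "dx :: 'a poly3 \<Rightarrow> _" unfolding dx_def by (rule X.derivation_map_poly)
  interpret DY: derivation "dy :: 'a poly3 \<Rightarrow> _" unfolding dy_def by (rule Y.derivation_map_poly)
  have coeff_dx: "coeff (dx p) i = ?X (coeff p i)" and coeff_dy: "coeff (dy p) i = ?Y (coeff p i)"
    for p :: "'a poly3" and i
    unfolding dx_def dy_def by (rule X.coeff_map_poly Y.coeff_map_poly)+
  have chain_x: "dx (p \<circ>\<^sub>p q) = dx p \<circ>\<^sub>p q + (pderiv p \<circ>\<^sub>p q) * dx q"
    and chain_y: "dy (p \<circ>\<^sub>p q) = dy p \<circ>\<^sub>p q + (pderiv p \<circ>\<^sub>p q) * dy q" for p q :: "'a poly3"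
    unfolding dx_def dy_def by (rule X.map_poly_pcompose Y.map_poly_pcompose)+
  have degree_dx: "degree (dx p) \<le> degree p" and degree_dy: "degree (dy p) \<le> degree p"
    for p :: "'a poly3"
    unfolding dx_def dy_def by (rule map_poly_degree_leq)+
  define n d where "n = degree v" and "d = degree u"
  have n: "n \<ge> 2" and d: "d > 0" using deg_v deg_u by (simp_all add: n_def d_def)
  have nd: "d < n * d" using n d by simp

  \<comment> \<open>At \<open>z^(n d)\<close> the trace equation sees only \<open>W\<close>. Its top
    coefficient is thus free of y, and so are both factors of that product.\<close>
  have lc: "lead_coeff v * lead_coeff u ^ n = coeff W (n * d)"
    using lead_coeff_comp[OF deg_u, of v] by (simp add: W_def degree_pcompose n_def d_def)
  have "dy W = - dx u" using trace by (simp add: add_eq_0_iff)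
  then have "?Y (coeff W (n * d)) = - ?X (coeff u (n * d))"
    by (metis coeff_dx coeff_dy coeff_minus)
  also have "coeff u (n * d) = 0" using nd by (simp add: coeff_eq_0 d_def)
  finally have "?Y (lead_coeff v * lead_coeff u ^ n) = 0" unfolding lc by simp
  then have "degree (lead_coeff v * lead_coeff u ^ n) = 0" by (simp only: pderiv_eq_0_iff)
  moreover have nz: "lead_coeff v \<noteq> 0" "lead_coeff u \<noteq> 0" using deg_u deg_v by auto
  ultimately have deg_lc: "degree (lead_coeff v) = 0" "degree (lead_coeff u) = 0"
    using n by (auto simp: degree_mult_eq degree_power_eq)

  \<comment> \<open>The product of \<open>pderiv v\<close> at \<open>u\<close> with
    \<open>dy u\<close> has z-degree at most \<open>(n - 1) d\<close>, which its first factor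
    already attains. So \<open>dy u\<close> is free of z.\<close>
  have "coeff (dy v) n = 0"
    using deg_lc by (simp add: coeff_dy pderiv_eq_0_iff n_def)
  then have "degree (dy v) \<le> n - 1"
    using degree_dy[of v] by (intro degree_le_minus_1) (simp_all add: n_def)
  then have dv: "degree (dy v \<circ>\<^sub>p u) \<le> (n - 1) * d"
    by (simp add: degree_pcompose d_def)
  have "(pderiv v \<circ>\<^sub>p u) * dy u = - dx u - dy v \<circ>\<^sub>p u"
    using trace unfolding W_def chain_y by (simp add: algebra_simps add_eq_0_iff)
  moreover have "d \<le> (n - 1) * d" using n by (cases n) auto
  then have "degree (- dx u - dy v \<circ>\<^sub>p u) \<le> (n - 1) * d"
    using dv order.trans[OF degree_dx[of u]] by (intro degree_diff_le) (simp_all add: d_def)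
  moreover have "degree (pderiv v \<circ>\<^sub>p u) = (n - 1) * d"
    by (simp add: degree_pcompose degree_pderiv n_def d_def)
  moreover have "pderiv v \<circ>\<^sub>p u \<noteq> 0"
    using deg_u deg_v by (simp add: pcompose_eq_0_iff pderiv_eq_0_iff)
  ultimately have deg_dyu: "degree (dy u) = 0"
    by (cases "dy u = 0") (use degree_mult_eq[of "pderiv v \<circ>\<^sub>p u" "dy u"] in simp_all)

  \<comment> \<open>The split isolates the z-free part \<open>b\<close>, which carries all
    dependence of \<open>u\<close> on y. Shifting \<open>v\<close> by \<open>b\<close> turns
    \<open>W\<close> into a polynomial in \<open>A\<close>.\<close>
  define b where "b = coeff u 0"
  define A where "A = u - [:b:]"
  define V where "V = v \<circ>\<^sub>p [:b, 1:]"
  have u: "u = A + [:b:]" by (simp add: A_def)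
  have W: "W = V \<circ>\<^sub>p A"
  proof -
    have "[:b, 1:] \<circ>\<^sub>p A = u" by (simp add: pcompose_pCons u)
    then show ?thesis by (simp add: V_def W_def pcompose_assoc[symmetric])
  qed
  have A0: "coeff A 0 = 0" by (simp add: A_def b_def)
  have Ai: "coeff A i = coeff u i" if "i > 0" for i
    using that by (cases i) (auto simp: A_def)
  have deg_A: "degree A = d"
    unfolding A_def d_def diff_conv_add_uminus using d by (intro degree_add_eq_left) (simp add: d_def)
  have lcA: "coeff A d = lead_coeff u" using d by (simp add: Ai d_def)
  have deg_V: "degree V = n" by (simp add: V_def degree_pcompose n_def)
  have dyA: "dy A = 0"
  proof (rule poly_eqI)
    show "coeff (dy A) i = coeff 0 i" for i
      using deg_dyu A0 Ai[of i] coeff_eq_0[of "dy u" i] by (cases "i = 0") (auto simp: coeff_dy)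
  qed

  have dyW: "dy W = dy V \<circ>\<^sub>p A" unfolding W chain_y dyA by simp
  have dxu: "dx u = dx A + [:?X b:]" unfolding u DX.add by (simp add: dx_const)
  have eq: "dy V \<circ>\<^sub>p A = - dx A - [:?X b:]"
    using trace unfolding dyW dxu by (simp add: algebra_simps add_eq_0_iff)
  have "degree (- dx A - [:?X b:]) \<le> d"
    using degree_dx[of A] deg_A by (intro degree_diff_le) simp_all
  then have "degree (dy V) * d \<le> 1 * d" by (simp flip: eq add: degree_pcompose deg_A)
  then have "degree (dy V) \<le> 1" using d by simp
  then have "dy V = [:coeff (dy V) 0, coeff (dy V) 1:]"
    by (intro poly_eqI) (auto simp: coeff_pCons coeff_eq_0 split: nat.split)
  then obtain s r where sr: "dy V = [:s, r:]" by blast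
  have eq': "[:s:] + Polynomial.smult r A = - dx A - [:?X b:]"
    using eq unfolding sr by (simp add: pcompose_pCons mult.commute)
  obtain p where p: "lead_coeff u = [:p:]" "p \<noteq> 0"
    using deg_lc nz by (metis degree_eq_zeroE pCons_0_0)
  \<comment> \<open>At \<open>z^d\<close> this reads \<open>r p = - p'\<close>. In characteristic 0
    a nonzero \<open>p\<close> dividing its own derivative is constant, so
    \<open>r = 0\<close>.\<close>
  have "coeff ([:s:] + Polynomial.smult r A) d = coeff (- dx A - [:?X b:]) d"
    unfolding eq' ..
  then have rp: "r * [:p:] = - [:pderiv p:]"
    using d lcA p by (cases d) (simp_all add: coeff_dx Polynomial.map_poly_pCons)
  have "coeff r 0 * p = - pderiv p"
    using arg_cong[OF rp, of "\<lambda>f. coeff f 0"] by (simp add: mult.commute)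
  then have "p dvd pderiv p" by (metis dvd_minus_iff dvd_triv_right)
  then have "pderiv p = 0" by (simp add: pderiv_eq_0_iff)
  with rp p have r: "r = 0" by simp
  have "s = - ?X b" using arg_cong[OF eq', of "\<lambda>f. coeff f 0"] r A0 by (simp add: coeff_dx)
  then have dyV: "dy V = [:- ?X b:]" and dxA: "dx A = 0"
    using sr eq' r by (auto simp: algebra_simps)

  define b1 b2 h1 h2 where "b1 = ?X b" and "b2 = ?Y b" and "h1 = ?X h" and "h2 = ?Y h"
  have grad: "dx u = [:b1:]" "dy u = [:b2:]" "dz u = pderiv A"
    "dx W = dx V \<circ>\<^sub>p A" "dy W = [:- b1:]" "dz W = (pderiv V \<circ>\<^sub>p A) * pderiv A"
    using dxu dxA dyA dyV dyW by (simp_all add: u DY.add W chain_x dz_def pderiv_pcompose pderiv_add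
        b1_def b2_def dy_const)
  have A': "pderiv A \<noteq> 0" using d deg_A by (simp add: pderiv_eq_0_iff)

  \<comment> \<open>\<open>P\<close> at \<open>A\<close> is the determinant divided by
    \<open>pderiv A\<close>. Substituting the nonconstant \<open>A\<close> is injective, so
    \<open>P\<close> itself vanishes.\<close>
  define P where "P = pderiv V * [:b2 * h1 - b1 * h2:] + dx V * [:h2:] + [:b1 * h1:]"
  have PA: "P \<circ>\<^sub>p A = (pderiv V \<circ>\<^sub>p A) * [:b2 * h1 - b1 * h2:] + (dx V \<circ>\<^sub>p A) * [:h2:] + [:b1 * h1:]"
    by (simp only: P_def pcompose_add pcompose_mult pcompose_const)
  have "pderiv A * (P \<circ>\<^sub>p A) = dx u * (- (dz W * [:h2:])) + dy u * (dz W * [:h1:])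
      + dz u * (dx W * [:h2:] - dy W * [:h1:])"
    unfolding grad PA by (simp add: algebra_simps smult_diff_left)
  then have "pderiv A * (P \<circ>\<^sub>p A) = 0" using det by (simp add: h1_def h2_def)
  then have P: "P = 0" using A' d deg_A by (simp add: pcompose_eq_0_iff)
  define m where "m = coeff (pderiv V) (n - 1)"
  have m: "m \<noteq> 0"
  proof -
    have "degree (pderiv V) = n - 1" "pderiv V \<noteq> 0"
      using n deg_V by (auto simp: degree_pderiv pderiv_eq_0_iff)
    then show ?thesis by (metis leading_coeff_0_iff m_def)
  qed
  \<comment> \<open>This form of \<open>n\<close> shows that \<open>n - 1\<close> is positive, so
    constant terms do not enter that coefficient.\<close>
  define n' where "n' = n - 2"
  have n': "n = Suc (Suc n')" using n by (simp add: n'_def)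
  have "coeff P i = coeff (pderiv V) i * (b2 * h1 - b1 * h2) + coeff (dx V) i * h2
      + coeff [:b1 * h1:] i" for i
    by (simp add: P_def mult.commute)
  then have coeff_P: "coeff (pderiv V) i * (b2 * h1 - b1 * h2) + coeff (dx V) i * h2
      + coeff [:b1 * h1:] i = 0" for i
    unfolding P by simp
  have P0: "coeff (pderiv V) 0 * (b2 * h1 - b1 * h2) + coeff (dx V) 0 * h2 + b1 * h1 = 0"
    using coeff_P[of 0] by (simp only: coeff_pCons_0)
  have Pn1: "m * (b2 * h1 - b1 * h2) + coeff (dx V) (n - 1) * h2 = 0"
    using coeff_P[of "n - 1"] by (simp add: m_def n')
  have Pn: "coeff (dx V) n * h2 = 0"
    using coeff_P[of n] deg_V by (simp add: n' coeff_pderiv coeff_eq_0)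
  define Q where "Q = [:h1:] + pderiv V * [:h2:]"
  have sum2: "[:b1 * b1:] + [:b2:] * (dx V \<circ>\<^sub>p A) + pderiv A * (Q \<circ>\<^sub>p A) = 0"
  proof -
    have "[:b1 * b1:] + [:b2:] * (dx V \<circ>\<^sub>p A) + pderiv A * (Q \<circ>\<^sub>p A) = -
      (dx u * dy W - dy u * dx W - dz u * [:h1:] - dz W * [:h2:])"
      unfolding grad Q_def pcompose_add pcompose_mult pcompose_const
      by (simp add: algebra_simps)
    then show ?thesis using minors by (simp add: h1_def h2_def)
  qed

  have h2: "h2 = 0"
  proof (rule ccontr)
    assume h2: "h2 \<noteq> 0"
    with Pn have "coeff (dx V) n = 0" by simp
    then have dxV: "degree (dx V) \<le> n - 1"
      using degree_dx[of V] deg_V by (intro degree_le_minus_1) simp_all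
    \<comment> \<open>With \<open>h2\<close> nonzero, the last term of \<open>sum2\<close> has
      z-degree \<open>(d - 1) + (n - 1) d\<close>, while the others stay within
      \<open>(n - 1) d\<close>. Hence \<open>d = 1\<close> and \<open>A = c z\<close>.\<close>
    have "degree (pderiv V * [:h2:]) = n - 1"
      using h2 deg_V by (simp add: degree_pderiv)
    then have deg_Q: "degree Q = n - 1"
      unfolding Q_def using n' by (subst degree_add_eq_right) simp_all
    then have "Q \<circ>\<^sub>p A \<noteq> 0" using n' d deg_A by (subst pcompose_eq_0_iff) auto
    then have "degree (pderiv A * (Q \<circ>\<^sub>p A)) = (d - 1) + (n - 1) * d"
      using A' by (simp add: degree_mult_eq degree_pderiv degree_pcompose deg_A deg_Q)
    moreover have "pderiv A * (Q \<circ>\<^sub>p A) = - [:b1 * b1:] - [:b2:] * (dx V \<circ>\<^sub>p A)"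
      using sum2 by (simp add: algebra_simps add_eq_0_iff)
    moreover have "degree (- [:b1 * b1:] - [:b2:] * (dx V \<circ>\<^sub>p A)) \<le> (n - 1) * d"
      using dxV by (intro degree_diff_le order.trans[OF degree_mult_le])
        (simp_all add: degree_pcompose deg_A)
    ultimately have "d = 1" using d by simp
    define c where "c = coeff A 1"
    have c: "c \<noteq> 0" using lcA nz \<open>d = 1\<close> by (simp add: c_def)
    have "pderiv A = [:c:]"
      by (rule poly_eqI) (use deg_A \<open>d = 1\<close> in
          \<open>auto simp: coeff_pderiv c_def coeff_pCons coeff_eq_0 split: nat.split\<close>)
    with sum2 have "([:b1 * b1:] + [:b2:] * dx V + [:c:] * Q) \<circ>\<^sub>p A = 0"
      by (simp add: pcompose_add pcompose_mult pcompose_smult)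
    then have R: "[:b1 * b1:] + [:b2:] * dx V + [:c:] * Q = 0"
      using d deg_A by (simp add: pcompose_eq_0_iff)
    have "coeff [:b1 * b1:] i + b2 * coeff (dx V) i + c * (coeff [:h1:] i + coeff (pderiv V) i * h2)
        = coeff ([:b1 * b1:] + [:b2:] * dx V + [:c:] * Q) i" for i
      by (simp add: Q_def mult.commute)
    then have coeff_Q: "coeff [:b1 * b1:] i + b2 * coeff (dx V) i
        + c * (coeff [:h1:] i + coeff (pderiv V) i * h2) = 0" for i
      unfolding R by simp
    have R0: "b1 * b1 + b2 * coeff (dx V) 0 + c * (h1 + coeff (pderiv V) 0 * h2) = 0"
      using coeff_Q[of 0] by (simp only: coeff_pCons_0)
    have Rn1: "b2 * coeff (dx V) (n - 1) + c * (m * h2) = 0"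
      using coeff_Q[of "n - 1"] by (simp add: m_def n')
    from quadratic_relations_contradiction[OF R0 Rn1 Pn1 P0 c m] h2 show False by simp
  qed
  have bh: "b2 * h1 = 0" using Pn1 m h2 by simp
  then have bh1: "b1 * h1 = 0" using P0 by (simp add: h2 bh del: mult_eq_0_iff)
  have S: "[:b1 * b1:] + [:b2:] * (dx V \<circ>\<^sub>p A) + pderiv A * [:h1:] = 0"
    using sum2 h2 by (simp add: Q_def)
  \<comment> \<open>Multiplying \<open>S\<close> by \<open>h1\<close> kills every term containing
    \<open>b1\<close> or \<open>b2\<close>.\<close>
  have "pderiv A * [:h1:] * [:h1:]
      = ([:b1 * b1:] + [:b2:] * (dx V \<circ>\<^sub>p A) + pderiv A * [:h1:]) * [:h1:]
        - [:b1 * (b1 * h1):] - (dx V \<circ>\<^sub>p A) * [:b2 * h1:]"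
    by (simp add: algebra_simps)
  also have "\<dots> = 0" unfolding S bh bh1 by simp
  finally have "pderiv A * [:h1:] * [:h1:] = 0" .
  with A' have "h1 = 0" by simp
  with h2 show ?thesis by (simp add: h1_def h2_def)
qed

section \<open>Assembly of the linear dependence\<close>

lemma lin_dependent3I:
  assumes "c0 \<noteq> 0 \<or> c1 \<noteq> 0 \<or> c2 \<noteq> 0"
    and "[:[:[:c0:]:]:] * f0 + [:[:[:c1:]:]:] * f1 + [:[:[:c2:]:]:] * f2 = 0"
  shows "lin_dependent3 [f0, f1, f2]"
proof -
  have "\<exists>i<3. [c0, c1, c2] ! i \<noteq> 0"
    using assms(1) by (auto simp: numeral_3_eq_3 less_Suc_eq)
  then show ?thesis
    unfolding lin_dependent3_def using assms(2)
    by (intro exI[of _ "\<lambda>i. [c0, c1, c2] ! i"]) (simp add: numeral_3_eq_3 add.assoc)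
qed

theorem theorem3p2:
  fixes u :: "'a::{alg_closed_field, field_char_0} poly3"
    and v :: "'a poly3"
    and h :: "'a poly2"
    and H :: "'a poly3 list"
  assumes H_def: "H = [u, v \<circ>\<^sub>p u, [:h:]]"
    and H_zero: "\<forall>f \<in> set H. eval3 f 0 0 0 = 0"
    and deg_v: "degree v \<ge> 2"
    and nilp: "nilpotent_mat (jacobian3 H)"
  shows "lin_dependent3 H"
proof -
  let ?W = "v \<circ>\<^sub>p u"
  have J: "jacobian3 H \<in> carrier_mat 3 3"
    by (simp add: jacobian3_def H_def mat_of_rows_list_def numeral_3_eq_3)
  have entries: "jacobian3 H $$ (0,0) = dx u" "jacobian3 H $$ (0,1) = dy u" "jacobian3 H $$ (0,2) = dz u"
    "jacobian3 H $$ (1,0) = dx ?W" "jacobian3 H $$ (1,1) = dy ?W" "jacobian3 H $$ (1,2) = dz ?W"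
    "jacobian3 H $$ (2,0) = [:map_poly pderiv h:]" "jacobian3 H $$ (2,1) = [:pderiv h:]"
    "jacobian3 H $$ (2,2) = 0"
    by (simp_all add: jacobian3_def H_def mat_of_rows_list_def dx_const dy_const dz_const)
  note nil = nilpotent_mat_3[OF J nilp, unfolded det_3[OF J] entries]
  have trace: "dx u + dy ?W = 0" using nil(1) by simp
  have minors: "dx u * dy ?W - dy u * dx ?W - dz u * [:map_poly pderiv h:] - dz ?W * [:pderiv h:] = 0"
    using nil(2) by simp
  show ?thesis
  proof (cases "degree u = 0")
    case True
    then obtain b where u: "u = [:b:]" by (rule degree_eq_zeroE)
    define w where "w = poly v b"
    have W: "?W = [:w:]" unfolding u w_def by (rule pcompose_pCons_0)
    have "map_poly pderiv b + pderiv w = 0"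
      "map_poly pderiv b * pderiv w - pderiv b * map_poly pderiv w = 0"
      using trace minors unfolding W unfolding u by (simp_all add: dx_const dy_const dz_const mult.commute)
    then obtain c d e where cd: "c \<noteq> 0 \<or> d \<noteq> 0" and e: "const2 c * b + const2 d * w = const2 e"
      using nilpotent_jacobian_2 by blast
    \<comment> \<open>Evaluation at the origin, where \<open>H\<close> vanishes, removes the
      constant \<open>e\<close>.\<close>
    have "poly (poly b 0) 0 = 0" "poly (poly w 0) 0 = 0"
      using H_zero[unfolded H_def W] by (simp_all add: u eval3_def)
    then have "poly (poly (const2 c * b + const2 d * w) 0) 0 = 0" by simp
    then have "e = 0" unfolding e by simp
    with cd e show ?thesis
      unfolding H_def W unfolding u by (intro lin_dependent3I[of c d 0]) simp_all
  next
    case False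
    have "dx u * (- (dz ?W * [:pderiv h:])) + dy u * (dz ?W * [:map_poly pderiv h:])
      + dz u * (dx ?W * [:pderiv h:] - dy ?W * [:map_poly pderiv h:]) = 0"
      using nil(3) by simp
    then have "map_poly pderiv h = 0 \<and> pderiv h = 0"
      using nilpotent_jacobian_3_third_constant[OF _ deg_v trace minors] False by blast
    \<comment> \<open>A constant \<open>h\<close> vanishing at the origin is zero, so the
      coefficients (0, 0, 1) give a dependence.\<close>
    then obtain e where "h = const2 e" using gradient_eq_0_imp_const2 by blast
    moreover have "eval3 [:h:] 0 0 0 = 0" using H_zero by (simp add: H_def)
    ultimately have "h = 0" by (simp add: eval3_def)
    then show ?thesis
      unfolding H_def by (intro lin_dependent3I[of 0 0 1]) simp_all
  qed
qed

end
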